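(* Let $\varphi$ be a contractive RDS on $H$ satisfying the following condition (H'): there is a cone $H_+\subseteq H$ with induced partial order $\le$ and a dense subset $S\subseteq H$ such that $\varphi$ is monotone with respect to $\le$ on $S$, and for all $x,y\in S$ there is $z\in S$ with $x\le z$ and $y\le z$. Assume that $P_tf(x):=\mathbb{E}f(\varphi(t,\cdot)x)$ is a weak-$*$ mean ergodic Markovian semigroup on $B_b(H)$. Then for any random compact set $K(\omega)\subseteq H$, $$\mathrm{diam}(\varphi(t,\omega)K(\omega))\to0\quad\text{as }t\to\infty,\ \mathbb{P}\text{-a.s.}$$ In particular, each invariant random compact set $K$ (i.e. $\varphi(t,\omega)K(\omega)=K(\theta_t\omega)$) consists of a single random point.
   Context: $H$ is a separable Hilbert space. $(\Omega,\mathcal{F},\mathbb{P},\{\theta_t\}_{t\in\mathbb{R}})$ is a metric dynamical system: $(t,\omega)\mapsto\theta_t\omega$ is $(\mathcal{B}(\mathbb{R})\otimes\mathcal{F},\mathcal{F})$-measurable, $\theta_0=\mathrm{id}$, $\theta_{t+s}=\theta_t\circ\theta_s$, and each $\theta_t$ preserves $\mathbb{P}$. A random dynamical system (RDS) on $H$ is a measurable map $\varphi:\mathbb{R}_+\times\Omega\times H\to H$ with $\varphi(0,\omega)=\mathrm{id}_H$ and $\varphi(t+s,\omega)=\varphi(t,\theta_s\omega)\circ\varphi(s,\omega)$ for all $\omega\in\Omega$, $s,t\ge0$. A cone is a closed convex cone $H_+\subseteq H$ with $H_+\cap(-H_+)=\{0\}$; it induces the partial order $x\le y$ iff $y-x\in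 H_+$. $\varphi$ is monotone on $S\subseteq H$ if $\varphi(t,\omega)x\le\varphi(t,\omega)y$ for all $x\le y$ with $x,y\in S$ and all $t\ge0$, $\omega\in\Omega$. $\varphi$ is contractive if $t\mapsto\|\varphi(t,\omega)x-\varphi(t,\omega)y\|_H$ is non-increasing for all $x,y\in H$, $\omega\in\Omega$. $B_b(H)$ is the space of bounded measurable functions on $H$ and $\mathcal{M}_1$ the set of Borel probability measures on $H$. For a semigroup $P_t$ on $B_b(H)$, $P_t^*\mu(B):=\int_HP_t\mathbf{1}_B\,d\mu$ for Borel $B$ and $\mu\in\mathcal{M}_1$. For $T>0$, $Q^T\mu:=\frac1T\int_0^TP_r^*\mu\,dr$. $P_t$ is weak-$*$ mean ergodic if there is $\mu\in\mathcal{M}_1$ such that $Q^T\nu\to\mu$ weakly as $T\to\infty$ for all $\nu\in\mathcal{M}_1$. A random compact set is a family $\{K(\omega)\}_{\omega\in\Omega}$ of compact subsets of $H$ such that $\omega\mapsto d(x,K(\omega))$ is measurable for each $x\in H$. *)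

theory Defs
  imports "HOL-Probability.Probability"
begin

text \<open>
  The separable real Hilbert space \<open>H\<close> is the universe of a type \<open>'h\<close> of sort
  \<open>{real_inner, polish_space}\<close> (inner product space, complete, second countable).
\<close>

locale metric_dynamical_system = prob_space M for M :: "'w measure" +
  fixes \<theta> :: "real \<Rightarrow> 'w \<Rightarrow> 'w"
  assumes theta_measurable: "(\<lambda>(t, \<omega>). \<theta> t \<omega>) \<in> measurable (borel \<Otimes>\<^sub>M M) M"
    and theta_0: "\<And>\<omega>. \<omega> \<in> space M \<Longrightarrow> \<theta> 0 \<omega> = \<omega>"
    and theta_add: "\<And>s t \<omega>. \<omega> \<in> space M \<Longrightarrow> \<theta> (t + s) \<omega> = \<theta> t (\<theta> s \<omega>)"
    and theta_preserving: "\<And>t. distr M M (\<theta> t) = M"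

text \<open>The values \<open>\<phi> t\<close> for negative \<open>t\<close> are irrelevant.\<close>

locale random_dynamical_system = metric_dynamical_system M \<theta>
  for M :: "'w measure" and \<theta> :: "real \<Rightarrow> 'w \<Rightarrow> 'w" +
  fixes \<phi> :: "real \<Rightarrow> 'w \<Rightarrow> 'h::{real_inner, polish_space} \<Rightarrow> 'h"
  assumes phi_measurable:
      "(\<lambda>(t, \<omega>, x). \<phi> t \<omega> x)
        \<in> borel_measurable (restrict_space borel {0..} \<Otimes>\<^sub>M (M \<Otimes>\<^sub>M borel))"
    and phi_0: "\<And>\<omega>. \<omega> \<in> space M \<Longrightarrow> \<phi> 0 \<omega> = id"
    and phi_cocycle: "\<And>s t \<omega>. \<lbrakk>\<omega> \<in> space M; 0 \<le> s; 0 \<le> t\<rbrakk>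
        \<Longrightarrow> \<phi> (t + s) \<omega> = \<phi> t (\<theta> s \<omega>) \<circ> \<phi> s \<omega>"

definition contractive_rds ::
    "'w measure \<Rightarrow> (real \<Rightarrow> 'w \<Rightarrow> 'h::real_normed_vector \<Rightarrow> 'h) \<Rightarrow> bool" where
  "contractive_rds M \<phi> \<longleftrightarrow>
    (\<forall>\<omega>\<in>space M. \<forall>x y. antimono_on {0..} (\<lambda>t. norm (\<phi> t \<omega> x - \<phi> t \<omega> y)))"

definition order_cone :: "'h::real_normed_vector set \<Rightarrow> bool" where
  "order_cone C \<longleftrightarrow> closed C \<and> convex_cone C \<and> C \<inter> uminus ` C = {0}"

definition cone_le :: "'h::real_normed_vector set \<Rightarrow> 'h \<Rightarrow> 'h \<Rightarrow> bool" where
  "cone_le C x y \<longleftrightarrow> y - x \<in> C"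

definition monotone_rds_on ::
    "'w measure \<Rightarrow> (real \<Rightarrow> 'w \<Rightarrow> 'h::real_normed_vector \<Rightarrow> 'h) \<Rightarrow> 'h set \<Rightarrow> 'h set \<Rightarrow> bool" where
  "monotone_rds_on M \<phi> C S \<longleftrightarrow>
    (\<forall>t\<ge>0. \<forall>\<omega>\<in>space M. monotone_on S (cone_le C) (cone_le C) (\<phi> t \<omega>))"

definition order_condition ::
    "'w measure \<Rightarrow> (real \<Rightarrow> 'w \<Rightarrow> 'h::real_normed_vector \<Rightarrow> 'h) \<Rightarrow> bool" where
  "order_condition M \<phi> \<longleftrightarrow>
    (\<exists>C S. order_cone C \<and> closure S = UNIV \<and> monotone_rds_on M \<phi> C S \<and>
      (\<forall>x\<in>S. \<forall>y\<in>S. \<exists>z\<in>S. cone_le C x z \<and> cone_le C y z))"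

definition bounded_measurable :: "('h::topological_space \<Rightarrow> real) set" where
  "bounded_measurable = {f \<in> borel_measurable borel. bounded (range f)}"

definition markovian_semigroup ::
    "(real \<Rightarrow> ('h::topological_space \<Rightarrow> real) \<Rightarrow> 'h \<Rightarrow> real) \<Rightarrow> bool" where
  "markovian_semigroup P \<longleftrightarrow>
    (\<forall>t\<ge>0. \<forall>f\<in>bounded_measurable. P t f \<in> bounded_measurable) \<and>
    (\<forall>t\<ge>0. \<forall>f\<in>bounded_measurable. \<forall>g\<in>bounded_measurable. \<forall>a b.
        P t (\<lambda>x. a * f x + b * g x) = (\<lambda>x. a * P t f x + b * P t g x)) \<and>
    (\<forall>t\<ge>0. \<forall>f\<in>bounded_measurable. (\<forall>x. 0 \<le> f x) \<longrightarrow> (\<forall>x. 0 \<le> P t f x)) \<and>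
    (\<forall>t\<ge>0. P t (\<lambda>x. 1) = (\<lambda>x. 1)) \<and>
    (\<forall>f\<in>bounded_measurable. P 0 f = f) \<and>
    (\<forall>s\<ge>0. \<forall>t\<ge>0. \<forall>f\<in>bounded_measurable. P (t + s) f = P t (P s f))"

definition rds_semigroup ::
    "'w measure \<Rightarrow> (real \<Rightarrow> 'w \<Rightarrow> 'h \<Rightarrow> 'h) \<Rightarrow> real \<Rightarrow> ('h \<Rightarrow> real) \<Rightarrow> 'h \<Rightarrow> real" where
  "rds_semigroup M \<phi> t f x = (\<integral>\<omega>. f (\<phi> t \<omega> x) \<partial>M)"

text \<open>
  In the next two definitions \<^const>\<open>measure_of\<close> turns a set function into a measure; it
  falls back to the zero measure if the set function is not countably additive, which
  does not happen for the semigroup of a random dynamical system.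
\<close>

definition dual_semigroup ::
    "(real \<Rightarrow> ('h::topological_space \<Rightarrow> real) \<Rightarrow> 'h \<Rightarrow> real) \<Rightarrow> real \<Rightarrow> 'h measure \<Rightarrow> 'h measure" where
  "dual_semigroup P t \<mu> =
    measure_of UNIV (sets borel) (\<lambda>B. ennreal (\<integral>x. P t (indicator B) x \<partial>\<mu>))"

definition time_average ::
    "(real \<Rightarrow> ('h::topological_space \<Rightarrow> real) \<Rightarrow> 'h \<Rightarrow> real) \<Rightarrow> real \<Rightarrow> 'h measure \<Rightarrow> 'h measure" where
  "time_average P T \<mu> =
    measure_of UNIV (sets borel)
      (\<lambda>B. ennreal (1 / T * (LINT r:{0..T}|lborel. measure (dual_semigroup P r \<mu>) B)))"

text \<open>The library's weak convergence covers only sequences of measures on the real line.\<close>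

definition weakly_converges ::
    "('i \<Rightarrow> 'h::topological_space measure) \<Rightarrow> 'h measure \<Rightarrow> 'i filter \<Rightarrow> bool" where
  "weakly_converges \<mu>s \<mu> F \<longleftrightarrow>
    (\<forall>f :: 'h \<Rightarrow> real. continuous_on UNIV f \<and> bounded (range f) \<longrightarrow>
      ((\<lambda>i. \<integral>x. f x \<partial>\<mu>s i) \<longlongrightarrow> (\<integral>x. f x \<partial>\<mu>)) F)"

definition weak_star_mean_ergodic ::
    "(real \<Rightarrow> ('h::topological_space \<Rightarrow> real) \<Rightarrow> 'h \<Rightarrow> real) \<Rightarrow> bool" where
  "weak_star_mean_ergodic P \<longleftrightarrow>
    (\<exists>\<mu>\<in>space (prob_algebra borel). \<forall>\<nu>\<in>space (prob_algebra borel).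
      weakly_converges (\<lambda>T. time_average P T \<nu>) \<mu> at_top)"

text \<open>
  Empty fibres are allowed here.  Although \<^const>\<open>infdist\<close> is 0 (rather than infinite) for the
  empty set, in a space with more than one point this yields the same random compact sets
  as the convention that the distance to the empty set is infinite.
\<close>

definition random_compact_set :: "'w measure \<Rightarrow> ('w \<Rightarrow> 'h::metric_space set) \<Rightarrow> bool" where
  "random_compact_set M K \<longleftrightarrow>
    (\<forall>\<omega>\<in>space M. compact (K \<omega>)) \<and>
    (\<forall>x. (\<lambda>\<omega>. infdist x (K \<omega>)) \<in> borel_measurable M)"

text \<open>Invariance is required only almost surely, with a null set that may depend on \<open>t\<close>.\<close>

definition invariant_random_set ::
    "'w measure \<Rightarrow> (real \<Rightarrow> 'w \<Rightarrow> 'w) \<Rightarrow> (real \<Rightarrow> 'w \<Rightarrow> 'h \<Rightarrow> 'h) \<Rightarrow> ('w \<Rightarrow> 'h set) \<Rightarrow> bool" where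
  "invariant_random_set M \<theta> \<phi> K \<longleftrightarrow>
    (\<forall>t\<ge>0. AE \<omega> in M. \<phi> t \<omega> ` K \<omega> = K (\<theta> t \<omega>))"

end

theory Submission
  imports Defs
begin

text \<open>
  Start with two points \<open>x \<le> y\<close> of \<open>S\<close>.  Their trajectories stay ordered, and the law of each of
  them, averaged over time, converges to the same measure \<open>\<mu>\<close>.  Two random variables that are
  ordered and have the same law are almost surely equal; hence the two trajectories cannot stay
  apart.  As the distance of the trajectories never increases, it must converge to 0.

  To make this quantitative without passing to limits of joint laws, ordered pairs at distance at
  least \<open>\<eta>\<close> are detected by test functions of the single points
  (\<open>order_detecting_test_functions\<close>): a functional that is nonnegative on the cone increases by a
  fixed amount between the two points, provided that both lie near a compact set carrying most of
  \<open>\<mu>\<close>.  This rests on separation of points from a closed cone (\<open>dual_cone_separates\<close>) and on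
  compactness (\<open>order_cone_positive_near_compact\<close>).  Representing the time average of a Dirac measure
  as the law of the flow at an independent uniform time (\<open>time_average_dirac\<close>) then bounds
  the probability that the trajectories are \<open>\<eta>\<close>-apart at time \<open>T\<close> by time averages
  of these test functions (\<open>prob_distance_le_time_averages\<close>), and the bound becomes arbitrarily
  small as \<open>T\<close> grows.

  Any two points of \<open>S\<close> synchronize with a common upper bound, hence with each other, and outside a
  single null set this holds for all pairs from a countable dense set (\<open>dense_synchronization\<close>).
  Each \<open>\<phi> t \<omega>\<close> is nonexpansive, so finite nets carry the convergence over to compact sets
  (\<open>compact_diameter_tendsto_0\<close>).  For an invariant random compact set the diameter is
  a stationary process that converges to 0, and so it vanishes
  (\<open>invariant_set_subsingleton\<close>).
\<close>

section \<open>Cones in Hilbert space and test functions\<close>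

lemma infdist_lessE:
  assumes "infdist x A < r" "A \<noteq> {}"
  obtains a where "a \<in> A" "dist x a < r"
  using assms cInf_lessD[of "dist x ` A" r] by (auto simp: infdist_def)

text \<open>
  The bipolar property of a closed convex cone in a Hilbert space of any dimension.  The
  functional is \<open>p - z\<close>, where \<open>p\<close> is the nearest point of the cone to \<open>z\<close>.
\<close>

lemma dual_cone_separates:
  fixes C :: "'h::{real_inner, complete_space} set"
  assumes "closed C" "convex_cone C" "z \<notin> C"
  obtains u where "\<And>v. v \<in> C \<Longrightarrow> 0 \<le> u \<bullet> v" "u \<bullet> z < 0"
proof -
  have C: "0 \<in> C" "\<And>x y. x \<in> C \<Longrightarrow> y \<in> C \<Longrightarrow> x + y \<in> C"
    "\<And>x c. x \<in> C \<Longrightarrow> 0 \<le> c \<Longrightarrow> c *\<^sub>R x \<in> C"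
    using assms(2) by (auto simp: convex_cone_iff)
  define d where "d = infdist z C"
  have d0: "0 \<le> d" by (simp add: d_def infdist_nonneg)
  have d_le: "d \<le> dist z x" if "x \<in> C" for x
    using that by (simp add: d_def infdist_le)
  define A where "A n = C \<inter> cball z (d + 1 / real (Suc n))" for n
  \<comment> \<open>The near-minimal points of the cone form a decreasing sequence of closed sets, and the
    parallelogram law makes their diameters tend to 0.\<close>
  have "\<exists>p. \<Inter>(range A) = {p}"
  proof (rule decreasing_closed_nest_sing)
    show "closed (A n)" for n using assms(1) by (auto simp: A_def)
    show "A n \<noteq> {}" for n
    proof -
      have "\<exists>a\<in>C. dist z a < d + 1 / real (Suc n)"
        using C(1) infdist_lessE[of z C "d + 1 / real (Suc n)"] by (force simp: d_def)
      then show ?thesis by (force simp: A_def)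
    qed
    show "A n \<subseteq> A m" if "m \<le> n" for m n
    proof -
      have "1 / real (Suc n) \<le> 1 / real (Suc m)" using that by (simp add: frac_le)
      then show ?thesis by (force simp: A_def)
    qed
    fix e :: real assume e: "e > 0"
    have "(\<lambda>n. 4 * (d + 1 / real (Suc n))\<^sup>2 - 4 * d\<^sup>2) \<longlonglongrightarrow> 4 * (d + 0)\<^sup>2 - 4 * d\<^sup>2"
      by (intro tendsto_intros LIMSEQ_Suc[OF lim_1_over_n])
    then have "\<forall>\<^sub>F n in sequentially. 4 * (d + 1 / real (Suc n))\<^sup>2 - 4 * d\<^sup>2 < e\<^sup>2"
      using e by (intro order_tendstoD) auto
    then obtain n where n: "4 * (d + 1 / real (Suc n))\<^sup>2 - 4 * d\<^sup>2 < e\<^sup>2"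
      by (auto simp: eventually_sequentially)
    have "dist x y < e" if "x \<in> A n" "y \<in> A n" for x y
    proof -
      let ?r = "d + 1 / real (Suc n)"
      have xy: "x \<in> C" "y \<in> C" "norm (z - x) \<le> ?r" "norm (z - y) \<le> ?r"
        using that by (auto simp: A_def dist_norm)
      have "(1/2) *\<^sub>R (x + y) \<in> C" using C xy by auto
      then have "d \<le> norm (z - (1/2) *\<^sub>R (x + y))" using d_le by (auto simp: dist_norm)
      then have 1: "d\<^sup>2 \<le> (norm (z - (1/2) *\<^sub>R (x + y)))\<^sup>2" using d0 by (intro power_mono)
      have 2: "(norm (x - y))\<^sup>2 = 2 * (norm (z - x))\<^sup>2 + 2 * (norm (z - y))\<^sup>2
                 - 4 * (norm (z - (1/2) *\<^sub>R (x + y)))\<^sup>2"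
        unfolding power2_norm_eq_inner by (simp add: algebra_simps inner_commute)
      have 3: "(norm (z - x))\<^sup>2 \<le> ?r\<^sup>2" "(norm (z - y))\<^sup>2 \<le> ?r\<^sup>2"
        using xy by (auto intro!: power_mono)
      have "(norm (x - y))\<^sup>2 < e\<^sup>2" using 1 2 3 n by linarith
      then show ?thesis using e by (simp add: dist_norm power2_less_imp_less)
    qed
    then show "\<exists>n. \<forall>x\<in>A n. \<forall>y\<in>A n. dist x y < e" by blast
  qed
  then obtain p where p: "\<And>n. p \<in> A n" by blast
  have pC: "p \<in> C" using p[of 0] by (simp add: A_def)
  have p_min: "norm (z - p) \<le> norm (z - x)" if "x \<in> C" for x
  proof -
    have "(\<lambda>n. d + 1 / real (Suc n)) \<longlonglongrightarrow> d + 0"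
      by (intro tendsto_intros LIMSEQ_Suc[OF lim_1_over_n])
    moreover have "norm (z - p) \<le> d + 1 / real (Suc n)" for n
      using p[of n] by (auto simp: A_def dist_norm)
    ultimately have "norm (z - p) \<le> d + 0" by (intro LIMSEQ_le_const) auto
    then show ?thesis using d_le[OF that] by (simp add: dist_norm)
  qed
  \<comment> \<open>First-order condition for the minimum of the distance to \<open>z\<close>, in a direction \<open>v\<close> that points into the cone.\<close>
  have nonneg: "0 \<le> (p - z) \<bullet> v" if v: "\<And>s. 0 < s \<Longrightarrow> s \<le> 1 \<Longrightarrow> p + s *\<^sub>R v \<in> C" for v
  proof -
    have "0 \<le> 2 * ((p - z) \<bullet> v) + s * (norm v)\<^sup>2" if s: "0 < s" "s \<le> 1" for s
    proof -
      have "(norm (z - p))\<^sup>2 \<le> (norm (z - (p + s *\<^sub>R v)))\<^sup>2"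
        using p_min[OF v[OF s]] by (intro power_mono) auto
      also have "\<dots> = (norm (z - p))\<^sup>2 + s * (2 * ((p - z) \<bullet> v) + s * (norm v)\<^sup>2)"
        unfolding power2_norm_eq_inner by (simp add: algebra_simps inner_commute)
      finally show ?thesis using s(1) by (simp add: zero_le_mult_iff)
    qed
    then have "\<forall>\<^sub>F s in at_right 0. 0 \<le> 2 * ((p - z) \<bullet> v) + s * (norm v)\<^sup>2"
      by (intro eventually_at_rightI[of 0 1]) auto
    moreover have "((\<lambda>s. 2 * ((p - z) \<bullet> v) + s * (norm v)\<^sup>2)
        \<longlongrightarrow> 2 * ((p - z) \<bullet> v) + 0 * (norm v)\<^sup>2) (at_right 0)"
      by (intro tendsto_intros)
    ultimately have "0 \<le> 2 * ((p - z) \<bullet> v) + 0 * (norm v)\<^sup>2"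
      by (intro tendsto_lowerbound) auto
    then show ?thesis by simp
  qed
  have "0 \<le> (p - z) \<bullet> (- p)"
  proof (rule nonneg)
    fix s :: real assume "0 < s" "s \<le> 1"
    then have "(1 - s) *\<^sub>R p \<in> C" using C(3) pC by simp
    then show "p + s *\<^sub>R (- p) \<in> C" by (simp add: algebra_simps)
  qed
  moreover have "0 < (p - z) \<bullet> (p - z)" using pC assms(3) by auto
  ultimately have "(p - z) \<bullet> z < 0" by (simp add: inner_diff_right)
  moreover have "0 \<le> (p - z) \<bullet> v" if "v \<in> C" for v
    using C pC that by (intro nonneg) auto
  ultimately show ?thesis using that by blast
qed

text \<open>
  In infinite dimensions no single functional need control the norm on the cone.  Near a compact
  set one does: each point of the set is in the cone and nonzero, so that some dual functional is
  positive there, or has a neighbourhood that contains no cone vector of norm at least \<open>\<eta>\<close>.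
  Finitely many such neighbourhoods cover the set, and the sum of their functionals works
  because each summand is nonnegative on the cone.
\<close>

lemma order_cone_positive_near_compact:
  fixes C :: "'h::{real_inner, complete_space} set"
  assumes C: "order_cone C" and D: "compact D" and eta: "0 < \<eta>"
  obtains u c \<delta> where "0 < c" "0 < \<delta>" "\<And>v. v \<in> C \<Longrightarrow> 0 \<le> u \<bullet> v"
    "\<And>p w. p \<in> D \<Longrightarrow> w \<in> C \<Longrightarrow> \<eta> \<le> norm w \<Longrightarrow> dist p w < \<delta> \<Longrightarrow> c \<le> u \<bullet> w"
proof -
  have clC: "closed C" and ccC: "convex_cone C" and pointed: "C \<inter> uminus ` C = {0}"
    using C by (auto simp: order_cone_def)
  have local: "\<exists>u c e. 0 < c \<and> 0 < e \<and> (\<forall>v\<in>C. 0 \<le> u \<bullet> v) \<and>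
      (\<forall>w\<in>C. \<eta> \<le> norm w \<longrightarrow> dist p w < e \<longrightarrow> c \<le> u \<bullet> w)" for p :: 'h
  proof (cases "p \<in> C \<and> p \<noteq> 0")
    case True
    then have "- p \<notin> C" using pointed by (metis IntI image_eqI minus_minus singletonD)
    then obtain u where u: "\<And>v. v \<in> C \<Longrightarrow> 0 \<le> u \<bullet> v" "u \<bullet> (- p) < 0"
      using dual_cone_separates[OF clC ccC] by metis
    have "open {w. u \<bullet> p / 2 < u \<bullet> w}" by (intro open_Collect_less continuous_intros)
    moreover have "p \<in> {w. u \<bullet> p / 2 < u \<bullet> w}" using u(2) by simp
    ultimately obtain e where e: "0 < e" "ball p e \<subseteq> {w. u \<bullet> p / 2 < u \<bullet> w}"
      by (meson openE)
    have "0 < u \<bullet> p / 2" using u(2) by simp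
    moreover have "\<forall>w\<in>C. \<eta> \<le> norm w \<longrightarrow> dist p w < e \<longrightarrow> u \<bullet> p / 2 \<le> u \<bullet> w"
      using e(2) by (force simp: subset_iff)
    ultimately show ?thesis using e(1) u(1) by blast
  next
    case False
    have "open (- (C \<inter> {w. \<eta> \<le> norm w}))"
      using clC by (intro open_Compl closed_Int closed_Collect_le continuous_intros)
    moreover have "p \<in> - (C \<inter> {w. \<eta> \<le> norm w})" using False eta by auto
    ultimately obtain e where "0 < e" "ball p e \<subseteq> - (C \<inter> {w. \<eta> \<le> norm w})"
      by (meson openE)
    \<comment> \<open>No cone vector of norm at least \<open>\<eta>\<close> lies in this ball, so the trivial functional and any bound will do.\<close>
    then show ?thesis by (intro exI[of _ 0] exI[of _ 1] exI[of _ e]) (auto simp: subset_iff)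
  qed
  then obtain u c e where loc: "\<And>p. 0 < c p" "\<And>p. 0 < e p" "\<And>p v. v \<in> C \<Longrightarrow> 0 \<le> u p \<bullet> v"
      "\<And>p w. w \<in> C \<Longrightarrow> \<eta> \<le> norm w \<Longrightarrow> dist p w < e p \<Longrightarrow> c p \<le> u p \<bullet> (w::'h)"
    by metis
  have "D \<subseteq> (\<Union>p\<in>D. ball p (e p / 2))" using loc(2) by auto
  then obtain F where F: "F \<subseteq> D" "finite F" "D \<subseteq> (\<Union>p\<in>F. ball p (e p / 2))"
    using compactE_image[OF D, of D "\<lambda>p. ball p (e p / 2)"] by auto
  define c' where "c' = Min (insert 1 (c ` F))"
  define \<delta> where "\<delta> = Min (insert 1 ((\<lambda>p. e p / 2) ` F))"
  show ?thesis
  proof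
    show "0 < c'" using F(2) loc(1) by (auto simp: c'_def)
    show "0 < \<delta>" using F(2) loc(2) by (auto simp: \<delta>_def)
    show "0 \<le> (\<Sum>p\<in>F. u p) \<bullet> v" if "v \<in> C" for v
      using loc(3) that by (auto simp: inner_sum_left intro: sum_nonneg)
    show "c' \<le> (\<Sum>p\<in>F. u p) \<bullet> w" if w: "p \<in> D" "w \<in> C" "\<eta> \<le> norm w" "dist p w < \<delta>" for p w
    proof -
      obtain q where q: "q \<in> F" "dist q p < e q / 2" using F(3) w(1) by auto
      have "\<delta> \<le> e q / 2" unfolding \<delta>_def using F(2) q(1) by (intro Min_le) auto
      then have "dist q w < e q" using dist_triangle[of q w p] q(2) w(4) by linarith
      then have "c q \<le> u q \<bullet> w" using loc(4) w by blast
      moreover have "c' \<le> c q" using F(2) q(1) by (auto simp: c'_def)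
      moreover have "u q \<bullet> w \<le> (\<Sum>p\<in>F. u p \<bullet> w)"
        using F(2) q(1) loc(3) w(2) by (intro member_le_sum) auto
      ultimately show ?thesis by (simp add: inner_sum_left)
    qed
  qed
qed

text \<open>
  The conclusion bounds the indicator of the event that two ordered points are far apart by a
  sum of functions of a \<^emph>\<open>single\<close> point each, so that expectations of it depend only on the
  two marginal laws.  Here \<open>h\<close> measures the distance to a compact set \<open>K0\<close> that carries most of
  \<open>\<mu>\<close>, and \<open>g\<close> is a truncated monotone functional.  If both points are near \<open>K0\<close> then their
  difference is near \<open>K0 - K0\<close>, so the functional separates them; otherwise \<open>h\<close> is 1 at one of
  the two points.
\<close>

lemma order_detecting_test_functions:
  fixes C :: "'h::{real_inner, polish_space} set"
  assumes C: "order_cone C" and "prob_space \<mu>" and sets: "sets \<mu> = sets borel"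
    and "0 < \<epsilon>" "0 < \<eta>"
  obtains h g :: "'h \<Rightarrow> real" where
    "continuous_on UNIV h" "bounded (range h)" "continuous_on UNIV g" "bounded (range g)"
    "(\<integral>x. h x \<partial>\<mu>) \<le> \<epsilon>"
    "\<And>x y. cone_le C x y \<Longrightarrow> indicator {\<eta>..} (norm (x - y)) \<le> h x + h y + (g y - g x)"
proof -
  interpret \<mu>: prob_space \<mu> by fact
  have space: "space \<mu> = UNIV" using sets_eq_imp_space_eq[OF sets] by simp
  note [measurable_cong] = sets
  obtain K where K: "compact K" "\<mu>.prob K > 1 - \<epsilon>"
  proof -
    have "ennreal (1 - \<epsilon>) < (SUP K \<in> {K. K \<subseteq> UNIV \<and> compact K}. emeasure \<mu> K)"
      using inner_regular[OF sets, of UNIV] \<mu>.emeasure_space_1 space \<open>0 < \<epsilon>\<close>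
      by (auto simp: ennreal_less_one_iff)
    then show ?thesis using that \<open>0 < \<epsilon>\<close>
      by (auto simp: less_SUP_iff \<mu>.emeasure_eq_measure ennreal_less_iff)
         (metis ennreal_less_iff measure_nonneg not_less_iff_gr_or_eq)
  qed
  \<comment> \<open>The origin makes the set nonempty and the norm bound \<open>B\<close> below nonnegative.\<close>
  define K0 where "K0 = insert 0 K"
  have K0: "compact K0" "K0 \<noteq> {}" "0 \<in> K0" "K \<subseteq> K0" using K by (auto simp: K0_def)
  define D where "D = {x - y |x y. x \<in> K0 \<and> y \<in> K0}"
  have "compact D" using compact_differences[OF K0(1) K0(1)] by (simp add: D_def)
  then obtain u c \<delta> where u: "0 < c" "0 < \<delta>" "\<And>v. v \<in> C \<Longrightarrow> 0 \<le> u \<bullet> v"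
    "\<And>p w. p \<in> D \<Longrightarrow> w \<in> C \<Longrightarrow> \<eta> \<le> norm w \<Longrightarrow> dist p w < \<delta> \<Longrightarrow> c \<le> u \<bullet> w"
    using order_cone_positive_near_compact[OF C _ \<open>0 < \<eta>\<close>] by metis
  obtain B where B: "\<And>x. x \<in> K0 \<Longrightarrow> norm x \<le> B"
    using compact_imp_bounded[OF K0(1)] by (auto simp: bounded_iff)
  \<comment> \<open>\<open>R\<close> bounds the functional on the \<open>\<delta>\<close>-neighbourhood of \<open>K0\<close>, so the truncation in \<open>g\<close> is inactive there.\<close>
  define R where "R = norm u * (B + \<delta>)"
  define h where "h x = min 1 (infdist x K0 / (\<delta> / 2))" for x
  define g where "g x = max (- R) (min R (u \<bullet> x)) / c" for x
  have "0 \<le> B" using B[OF K0(3)] by simp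
  then have R0: "0 \<le> R" using u(2) by (simp add: R_def)
  have h01: "0 \<le> h x" "h x \<le> 1" for x using u(2) by (auto simp: h_def infdist_nonneg)
  have near: "\<exists>a\<in>K0. dist x a < \<delta> / 2" if "h x < 1" for x
  proof -
    have "infdist x K0 < \<delta> / 2" using that u(2) by (auto simp: h_def min_def split: if_splits)
    then show ?thesis using infdist_lessE K0(2) by blast
  qed
  have bound: "\<bar>u \<bullet> x\<bar> \<le> R" if "h x < 1" for x
  proof -
    obtain a where a: "a \<in> K0" "dist x a < \<delta> / 2" using near \<open>h x < 1\<close> by blast
    have "norm x \<le> norm a + dist x a" by (metis dist_norm norm_triangle_sub)
    then have "norm x \<le> B + \<delta>" using a B[OF a(1)] u(2) by linarith
    then show ?thesis unfolding R_def
      by (meson Cauchy_Schwarz_ineq2 mult_left_mono norm_ge_zero order_trans)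
  qed
  have conth: "continuous_on UNIV h" unfolding h_def
    using u(2) by (intro continuous_intros) auto
  have contg: "continuous_on UNIV g" unfolding g_def
    using u(1) by (intro continuous_intros) auto
  have "(\<integral>x. h x \<partial>\<mu>) \<le> (\<integral>x. 1 - indicator K x \<partial>\<mu>)"
  proof (rule integral_mono)
    have [measurable]: "K \<in> sets borel" using K(1) by (simp add: borel_compact)
    have [measurable]: "h \<in> borel_measurable borel"
      using conth by (rule borel_measurable_continuous_onI)
    show "integrable \<mu> h" by (rule \<mu>.integrable_const_bound[of _ 1]) (use h01 in auto)
    show "integrable \<mu> (\<lambda>x. 1 - indicator K x :: real)"
      by (rule \<mu>.integrable_const_bound[of _ 1]) (auto simp: indicator_def)
    show "h x \<le> 1 - indicator K x" for x
      using h01 K0(4) by (auto simp: indicator_def) (auto simp: h_def)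
  qed
  also have "\<dots> = 1 - \<mu>.prob K"
    using K(1) by (subst Bochner_Integration.integral_diff)
      (auto simp: sets borel_compact space \<mu>.prob_space less_top[symmetric] \<mu>.prob_space[unfolded space])
  finally have int: "(\<integral>x. h x \<partial>\<mu>) \<le> \<epsilon>" using K(2) by simp
  have mono: "g x \<le> g y" if "cone_le C x y" for x y
  proof -
    have "u \<bullet> x \<le> u \<bullet> y" using u(3)[of "y - x"] that by (simp add: cone_le_def inner_diff_right)
    then show ?thesis using u(1) unfolding g_def by (intro divide_right_mono) auto
  qed
  show ?thesis
  proof (rule that)
    show "continuous_on UNIV h" "continuous_on UNIV g" by fact+
    show "bounded (range h)" using h01 by (auto simp: bounded_iff intro!: exI[of _ 1])
    show "bounded (range g)"
      unfolding bounded_iff g_def using u(1) R0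
      by (auto intro!: exI[of _ "R / c"] simp: divide_right_mono)
    show "(\<integral>x. h x \<partial>\<mu>) \<le> \<epsilon>" by fact
    show "indicator {\<eta>..} (norm (x - y)) \<le> h x + h y + (g y - g x)" if le: "cone_le C x y" for x y
    proof (cases "\<eta> \<le> norm (x - y) \<and> h x < 1 \<and> h y < 1")
      case False
      then show ?thesis using mono[OF le] h01[of x] h01[of y] by (auto simp: indicator_def)
    next
      case True
      obtain a where a: "a \<in> K0" "dist x a < \<delta> / 2" using near True by blast
      obtain b where b: "b \<in> K0" "dist y b < \<delta> / 2" using near True by blast
      have "dist (b - a) (y - x) \<le> dist y b + dist x a"
        unfolding dist_norm using norm_triangle_ineq[of "b - y" "x - a"]
        by (simp add: algebra_simps norm_minus_commute)
      moreover have "b - a \<in> D" using a b by (auto simp: D_def)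
      ultimately have "c \<le> u \<bullet> (y - x)"
        using a b le True by (intro u(4)) (auto simp: cone_le_def norm_minus_commute)
      moreover have "g x = u \<bullet> x / c" "g y = u \<bullet> y / c"
        using bound[of x] bound[of y] True by (auto simp: g_def)
      ultimately have "1 \<le> g y - g x"
        using u(1) by (simp add: inner_diff_right flip: diff_divide_distrib)
      then show ?thesis using h01[of x] h01[of y] by (auto simp: indicator_def)
    qed
  qed
qed

section \<open>Time averages as laws of the flow at a uniformly distributed time\<close>

context random_dynamical_system
begin

text \<open>
  Replacing negative times by 0 gives a map that is measurable on all of the real line, so that
  the product measures below need no restricted time space.
\<close>

lemma measurable_flow_extended:
  "(\<lambda>(r, \<omega>). \<phi> (max 0 r) \<omega> x) \<in> borel_measurable (borel \<Otimes>\<^sub>M M)"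
proof -
  have "(\<lambda>p. (max 0 (fst p), snd p, x))
      \<in> (borel \<Otimes>\<^sub>M M) \<rightarrow>\<^sub>M (restrict_space borel {0::real..} \<Otimes>\<^sub>M (M \<Otimes>\<^sub>M borel))"
    by (intro measurable_Pair measurable_restrict_space2) auto
  from measurable_compose[OF this phi_measurable] show ?thesis
    by (simp add: case_prod_beta')
qed

lemma measurable_flow:
  assumes "0 \<le> t"
  shows "(\<lambda>\<omega>. \<phi> t \<omega> x) \<in> borel_measurable M"
  using measurable_compose[OF measurable_Pair1'[of t borel M] measurable_flow_extended[of x]] assms
  by (simp add: max_absorb2)

lemma dual_semigroup_dirac:
  assumes P: "markovian_semigroup (rds_semigroup M \<phi>)" and t: "0 \<le> t"
  shows "dual_semigroup (rds_semigroup M \<phi>) t (return borel x)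
    = distr M borel (\<lambda>\<omega>. \<phi> t \<omega> x)"
proof -
  note [measurable] = measurable_flow[OF t]
  have eq: "ennreal (\<integral>y. rds_semigroup M \<phi> t (indicator B) y \<partial>return borel x)
      = emeasure (distr M borel (\<lambda>\<omega>. \<phi> t \<omega> x)) B" if [measurable]: "B \<in> sets borel" for B
  proof -
    have "indicator B \<in> bounded_measurable"
      by (auto simp: bounded_measurable_def bounded_iff indicator_def intro!: exI[of _ 1])
    then have "rds_semigroup M \<phi> t (indicator B) \<in> bounded_measurable"
      using P t by (simp add: markovian_semigroup_def)
    then have "(\<integral>y. rds_semigroup M \<phi> t (indicator B) y \<partial>return borel x)
        = rds_semigroup M \<phi> t (indicator B) x"
      by (intro integral_return) (auto simp: bounded_measurable_def)
    also have "\<dots> = (\<integral>\<omega>. indicator ((\<lambda>\<omega>. \<phi> t \<omega> x) -` B \<inter> space M) \<omega> \<partial>M)"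
      unfolding rds_semigroup_def
      by (rule Bochner_Integration.integral_cong) (auto simp: indicator_def)
    also have "\<dots> = measure (distr M borel (\<lambda>\<omega>. \<phi> t \<omega> x)) B"
      by (simp add: measure_distr)
    finally show ?thesis
      by (simp add: finite_measure.emeasure_eq_measure finite_measure_distr)
  qed
  have "dual_semigroup (rds_semigroup M \<phi>) t (return borel x)
      = measure_of UNIV (sets borel) (emeasure (distr M borel (\<lambda>\<omega>. \<phi> t \<omega> x)))"
    unfolding dual_semigroup_def
    by (rule measure_of_eq) (auto simp: eq sets.sigma_sets_eq[of borel, simplified])
  then show ?thesis using measure_of_of_measure[of "distr M borel (\<lambda>\<omega>. \<phi> t \<omega> x)"] by simp
qed

definition time_space :: "real \<Rightarrow> (real \<times> 'w) measure" where
  "time_space T = uniform_measure lborel {0..T} \<Otimes>\<^sub>M M"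

lemma prob_space_uniform_time: "0 < T \<Longrightarrow> prob_space (uniform_measure lborel {0..T::real})"
  by (rule prob_space_uniform_measure) auto

lemma prob_space_time_space:
  assumes "0 < T" shows "prob_space (time_space T)"
proof -
  interpret U: prob_space "uniform_measure lborel {0..T}" by (rule prob_space_uniform_time[OF assms])
  interpret pair_prob_space "uniform_measure lborel {0..T}" M ..
  show ?thesis unfolding time_space_def by (rule prob_space_axioms)
qed

lemma sets_time_space [measurable_cong]: "sets (time_space T) = sets (borel \<Otimes>\<^sub>M M)"
  unfolding time_space_def by (intro sets_pair_measure_cong) auto

text \<open>
  The law of the flow started at \<open>x\<close> and stopped at an independent time uniform in \<open>[0, T]\<close>.
  This form lets two initial points share the same time and the same noise, which couples their
  time averages.
\<close>

lemma time_average_dirac: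
  assumes P: "markovian_semigroup (rds_semigroup M \<phi>)" and T: "0 < T"
  shows "time_average (rds_semigroup M \<phi>) T (return borel x)
    = distr (time_space T) borel (\<lambda>(r, \<omega>). \<phi> (max 0 r) \<omega> x)"
    (is "_ = ?N")
proof -
  note [measurable] = measurable_flow_extended[of x]
  interpret U: prob_space "uniform_measure lborel {0..T}" by (rule prob_space_uniform_time[OF T])
  interpret UM: pair_prob_space "uniform_measure lborel {0..T}" M ..
  let ?p = "\<lambda>B r. measure (distr M borel (\<lambda>\<omega>. \<phi> (max 0 r) \<omega> x)) B"
  have eq: "ennreal (1 / T * (LINT r:{0..T}|lborel.
        measure (dual_semigroup (rds_semigroup M \<phi>) r (return borel x)) B)) = emeasure ?N B"
    if [measurable]: "B \<in> sets borel" for B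
  proof -
    have p_em: "ennreal (?p B r) = emeasure M (Pair r -` ((\<lambda>(r, \<omega>). \<phi> (max 0 r) \<omega> x) -` B \<inter> space (borel \<Otimes>\<^sub>M M)))"
      for r
      by (subst measure_distr) (auto simp: measurable_flow emeasure_eq_measure space_pair_measure
           intro!: arg_cong[where f = prob])
    have pm [measurable]: "?p B \<in> borel_measurable borel"
    proof -
      have "(\<lambda>r. emeasure M (Pair r -` ((\<lambda>(r, \<omega>). \<phi> (max 0 r) \<omega> x) -` B \<inter> space (borel \<Otimes>\<^sub>M M))))
          \<in> borel_measurable borel"
        by (rule measurable_emeasure_Pair) measurable
      then have "(\<lambda>r. enn2real (ennreal (?p B r))) \<in> borel_measurable borel"
        unfolding p_em by measurable
      then show ?thesis by simp
    qed
    have p01: "0 \<le> ?p B r" "?p B r \<le> 1" for r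
      by (auto intro!: prob_space.prob_le_1 prob_space_distr measurable_flow)
    have "emeasure ?N B = emeasure (time_space T) ((\<lambda>(r, \<omega>). \<phi> (max 0 r) \<omega> x) -` B \<inter> space (borel \<Otimes>\<^sub>M M))"
      by (subst emeasure_distr) (auto simp: time_space_def space_pair_measure)
    also have "\<dots> = (\<integral>\<^sup>+r. ennreal (?p B r) \<partial>uniform_measure lborel {0..T})"
      unfolding p_em time_space_def
      by (subst emeasure_pair_measure_alt) (auto simp: sets_time_space[unfolded time_space_def])
    also have "\<dots> = (\<integral>\<^sup>+r. ennreal (?p B r) * indicator {0..T} r \<partial>lborel) / T"
      using T by (subst nn_integral_uniform_measure) auto
    also have "(\<integral>\<^sup>+r. ennreal (?p B r) * indicator {0..T} r \<partial>lborel)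
        = (\<integral>\<^sup>+r. ennreal (indicator {0..T} r *\<^sub>R ?p B r) \<partial>lborel)"
      by (intro nn_integral_cong) (auto simp: indicator_def)
    also have "\<dots> = ennreal (LINT r:{0..T}|lborel. ?p B r)"
      unfolding set_lebesgue_integral_def
    proof (rule nn_integral_eq_integral)
      show "integrable lborel (\<lambda>r. indicator {0..T} r *\<^sub>R ?p B r)"
      proof (rule Bochner_Integration.integrable_bound)
        show "integrable lborel (indicator {0..T} :: real \<Rightarrow> real)"
          using T by (intro integrable_real_indicator) auto
        show "AE r in lborel. norm (indicator {0..T} r *\<^sub>R ?p B r) \<le> norm (indicator {0..T} r :: real)"
        proof (rule AE_I2)
          show "norm (indicator {0..T} r *\<^sub>R ?p B r) \<le> norm (indicator {0..T} r :: real)" for r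
            using p01[of r] by (cases "r \<in> {0..T}") auto
        qed
      qed measurable
    qed (use p01 in auto)
    also have "(LINT r:{0..T}|lborel. ?p B r) = (LINT r:{0..T}|lborel.
        measure (dual_semigroup (rds_semigroup M \<phi>) r (return borel x)) B)"
      by (intro set_lebesgue_integral_cong) (auto simp: dual_semigroup_dirac[OF P] max_absorb2)
    finally show ?thesis
      using T by (simp add: divide_ennreal set_lebesgue_integral_def integral_nonneg_AE)
  qed
  have "time_average (rds_semigroup M \<phi>) T (return borel x) = measure_of UNIV (sets borel) (emeasure ?N)"
    unfolding time_average_def
    by (rule measure_of_eq[OF _ eq]) (auto simp: sets.sigma_sets_eq[of borel, simplified])
  then show ?thesis using measure_of_of_measure[of ?N] by simp
qed

section \<open>Synchronization of pairs of points\<close>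

lemma contractive_mono_time:
  assumes "contractive_rds M \<phi>" "\<omega> \<in> space M" "0 \<le> s" "s \<le> t"
  shows "norm (\<phi> t \<omega> x - \<phi> t \<omega> y) \<le> norm (\<phi> s \<omega> x - \<phi> s \<omega> y)"
  using assms unfolding contractive_rds_def monotone_on_def by auto

lemma contractive_le_initial:
  assumes "contractive_rds M \<phi>" "\<omega> \<in> space M" "0 \<le> t"
  shows "norm (\<phi> t \<omega> x - \<phi> t \<omega> y) \<le> norm (x - y)"
  using contractive_mono_time[OF assms(1,2) order_refl assms(3), of x y] phi_0[OF assms(2)] by simp

text \<open>
  By contractivity, a distance of at least \<open>\<eta>\<close> at time \<open>T\<close> forces a distance of at least \<open>\<eta>\<close>
  at all earlier times.  At each of them the two points are ordered, so the test functions bound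
  the indicator of this event.  Averaging over time leaves the time averages of the two points.
\<close>

lemma prob_distance_le_time_averages:
  fixes h g :: "_ \<Rightarrow> real"
  assumes con: "contractive_rds M \<phi>" and P: "markovian_semigroup (rds_semigroup M \<phi>)"
    and mono: "monotone_rds_on M \<phi> C S" and S: "x \<in> S" "y \<in> S" "cone_le C x y"
    and h: "continuous_on UNIV h" "bounded (range h)" and g: "continuous_on UNIV g" "bounded (range g)"
    and hg: "\<And>x y. cone_le C x y \<Longrightarrow> indicator {\<eta>..} (norm (x - y)) \<le> h x + h y + (g y - g x)"
    and T: "0 < T"
  shows "prob {\<omega> \<in> space M. \<eta> \<le> norm (\<phi> T \<omega> x - \<phi> T \<omega> y)}
    \<le> (\<integral>z. h z \<partial>time_average (rds_semigroup M \<phi>) T (return borel x))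
      + (\<integral>z. h z \<partial>time_average (rds_semigroup M \<phi>) T (return borel y))
      + ((\<integral>z. g z \<partial>time_average (rds_semigroup M \<phi>) T (return borel y))
         - (\<integral>z. g z \<partial>time_average (rds_semigroup M \<phi>) T (return borel x)))"
proof -
  interpret U: prob_space "uniform_measure lborel {0..T}" by (rule prob_space_uniform_time[OF T])
  interpret UM: pair_prob_space "uniform_measure lborel {0..T}" M ..
  interpret Q: prob_space "time_space T" by (rule prob_space_time_space[OF T])
  let ?X = "\<lambda>x (r, \<omega>). \<phi> (max 0 r) \<omega> x"
  let ?A = "{\<omega> \<in> space M. \<eta> \<le> norm (\<phi> T \<omega> x - \<phi> T \<omega> y)}"
  note [measurable] = measurable_flow_extended
    borel_measurable_continuous_onI[OF h(1)] borel_measurable_continuous_onI[OF g(1)]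
  have "0 \<le> T" using T by simp
  note [measurable] = measurable_flow[OF \<open>0 \<le> T\<close>]
  have A [measurable]: "?A \<in> sets M" by measurable
  have avg: "(\<integral>z. f z \<partial>time_average (rds_semigroup M \<phi>) T (return borel x)) = (\<integral>q. f (?X x q) \<partial>time_space T)"
    if [measurable]: "f \<in> borel_measurable borel" for f :: "_ \<Rightarrow> real" and x
    unfolding time_average_dirac[OF P T] by (rule integral_distr) measurable
  have int: "integrable (time_space T) (\<lambda>q. f (?X x q))"
    if [measurable]: "f \<in> borel_measurable borel" and "bounded (range f)" for f :: "_ \<Rightarrow> real" and x
  proof -
    obtain B where "\<And>z. norm (f z) \<le> B" using \<open>bounded (range f)\<close> by (auto simp: bounded_iff)
    then show ?thesis by (intro Q.integrable_const_bound[of _ B]) auto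
  qed
  have "prob ?A = measure (time_space T) (UNIV \<times> ?A)"
    using emeasure_pair_measure_Times[of UNIV "uniform_measure lborel {0..T}" ?A]
      U.emeasure_space_1
    by (simp add: measure_def time_space_def)
  also have "\<dots> = (\<integral>q. indicator (UNIV \<times> ?A) q \<partial>time_space T)"
    by (subst Bochner_Integration.integral_indicator) (auto simp: space_pair_measure)
  also have "\<dots> \<le> (\<integral>q. h (?X x q) + h (?X y q) + (g (?X y q) - g (?X x q)) \<partial>time_space T)"
  proof (rule integral_mono_AE)
    show "integrable (time_space T) (\<lambda>q. h (?X x q) + h (?X y q) + (g (?X y q) - g (?X x q)))"
      using h g by (intro Bochner_Integration.integrable_add Bochner_Integration.integrable_diff int) auto
    show "integrable (time_space T) (indicator (UNIV \<times> ?A) :: _ \<Rightarrow> real)"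
      by (intro Q.integrable_const_bound[of _ 1]) (auto simp: indicator_def)
    have "AE q in time_space T. fst q \<in> {0..T}"
      unfolding time_space_def
    proof (rule UM.AE_pair_measure)
      have "Measurable.pred (time_space T) (\<lambda>q. fst q \<in> {0..T})" by measurable
      then show "{q \<in> space (uniform_measure lborel {0..T} \<Otimes>\<^sub>M M). fst q \<in> {0..T}}
          \<in> sets (uniform_measure lborel {0..T} \<Otimes>\<^sub>M M)"
        by (simp only: time_space_def pred_def)
      show "AE r in uniform_measure lborel {0..T}. AE \<omega> in M. fst (r, \<omega>) \<in> {0..T}"
        by (rule AE_uniform_measureI) auto
    qed
    then show "AE q in time_space T. indicator (UNIV \<times> ?A) q
        \<le> h (?X x q) + h (?X y q) + (g (?X y q) - g (?X x q))"
      using AE_space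
    proof eventually_elim
      case (elim q)
      obtain r \<omega> where q: "q = (r, \<omega>)" by (cases q)
      have r: "0 \<le> r" "r \<le> T" "\<omega> \<in> space M"
        using elim by (auto simp: q time_space_def space_pair_measure)
      have "indicator (UNIV \<times> ?A) q \<le> (indicator {\<eta>..} (norm (\<phi> r \<omega> x - \<phi> r \<omega> y)) :: real)"
        using contractive_mono_time[OF con r(3,1,2), of x y] by (auto simp: q indicator_def)
      also have "\<dots> \<le> h (\<phi> r \<omega> x) + h (\<phi> r \<omega> y) + (g (\<phi> r \<omega> y) - g (\<phi> r \<omega> x))"
        using mono r S by (intro hg) (auto simp: monotone_rds_on_def monotone_on_def)
      finally show ?case using r(1) by (simp add: q max_absorb2)
    qed
  qed
  also have "\<dots> = (\<integral>q. h (?X x q) \<partial>time_space T) + (\<integral>q. h (?X y q) \<partial>time_space T)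
      + ((\<integral>q. g (?X y q) \<partial>time_space T) - (\<integral>q. g (?X x q) \<partial>time_space T))"
    using h g by (simp add: int)
  finally show ?thesis by (simp add: avg)
qed

text \<open>
  Both time averages converge to the same \<open>\<mu>\<close>, so the two contributions of \<open>g\<close> cancel in the
  limit, and those of \<open>h\<close> are at most \<open>\<epsilon> / 3\<close> each.
\<close>

lemma ordered_pair_distance_tendsto_prob:
  assumes con: "contractive_rds M \<phi>" and P: "markovian_semigroup (rds_semigroup M \<phi>)"
    and erg: "weak_star_mean_ergodic (rds_semigroup M \<phi>)"
    and C: "order_cone C"
    and mono: "monotone_rds_on M \<phi> C S" and S: "x \<in> S" "y \<in> S" "cone_le C x y"
    and "0 < \<eta>"
  shows "((\<lambda>T. prob {\<omega> \<in> space M. \<eta> \<le> norm (\<phi> T \<omega> x - \<phi> T \<omega> y)}) \<longlongrightarrow> 0) at_top"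
proof (rule order_tendstoI)
  fix \<epsilon> :: real assume "0 < \<epsilon>"
  obtain \<mu> where \<mu>: "prob_space \<mu>" "sets \<mu> = sets borel"
    and conv: "\<And>\<nu>. \<nu> \<in> space (prob_algebra borel) \<Longrightarrow>
      weakly_converges (\<lambda>T. time_average (rds_semigroup M \<phi>) T \<nu>) \<mu> at_top"
    using erg by (auto simp: weak_star_mean_ergodic_def space_prob_algebra)
  obtain h g where h: "continuous_on UNIV h" "bounded (range h)"
    and g: "continuous_on UNIV g" "bounded (range g)" and small: "(\<integral>x. h x \<partial>\<mu>) \<le> \<epsilon> / 3"
    and hg: "\<And>x y. cone_le C x y \<Longrightarrow> indicator {\<eta>..} (norm (x - y)) \<le> h x + h y + (g y - g x)"
    using order_detecting_test_functions[OF C \<mu>, of "\<epsilon> / 3" \<eta>] \<open>0 < \<epsilon>\<close> \<open>0 < \<eta>\<close> by auto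
  let ?I = "\<lambda>f T x. \<integral>z. f z \<partial>time_average (rds_semigroup M \<phi>) T (return borel x)"
  have lim: "((\<lambda>T. ?I f T x) \<longlongrightarrow> (\<integral>z. f z \<partial>\<mu>)) at_top"
    if "continuous_on UNIV f" "bounded (range f)" for f :: "_ \<Rightarrow> real" and x
    using conv[of "return borel x"] that
    by (auto simp: space_prob_algebra prob_space_return weakly_converges_def)
  have "((\<lambda>T. ?I h T x + ?I h T y + (?I g T y - ?I g T x)) \<longlongrightarrow>
      (\<integral>z. h z \<partial>\<mu>) + (\<integral>z. h z \<partial>\<mu>) + ((\<integral>z. g z \<partial>\<mu>) - (\<integral>z. g z \<partial>\<mu>))) at_top"
    by (intro tendsto_intros lim h g)
  then have "\<forall>\<^sub>F T in at_top. ?I h T x + ?I h T y + (?I g T y - ?I g T x) < \<epsilon>"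
    by (rule order_tendstoD) (use small \<open>0 < \<epsilon>\<close> in simp)
  then show "\<forall>\<^sub>F T in at_top. prob {\<omega> \<in> space M. \<eta> \<le> norm (\<phi> T \<omega> x - \<phi> T \<omega> y)} < \<epsilon>"
    using eventually_gt_at_top[of 0]
  proof eventually_elim
    case (elim T)
    then show ?case using prob_distance_le_time_averages[OF con P mono S h g hg, of T] by linarith
  qed
qed (auto intro!: always_eventually elim: less_le_trans)

text \<open>
  Since the distance never increases, its almost sure limit exists, and convergence in
  probability identifies this limit.
\<close>

lemma distance_tendsto_AE_if_tendsto_prob:
  assumes con: "contractive_rds M \<phi>"
    and prob0: "\<And>\<eta>. 0 < \<eta> \<Longrightarrow>
      ((\<lambda>T. prob {\<omega> \<in> space M. \<eta> \<le> norm (\<phi> T \<omega> x - \<phi> T \<omega> y)}) \<longlongrightarrow> 0) at_top"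
  shows "AE \<omega> in M. ((\<lambda>t. norm (\<phi> t \<omega> x - \<phi> t \<omega> y)) \<longlongrightarrow> 0) at_top"
proof -
  let ?D = "\<lambda>\<eta> T. {\<omega> \<in> space M. \<eta> \<le> norm (\<phi> T \<omega> x - \<phi> T \<omega> y)}"
  have [measurable]: "(\<lambda>\<omega>. \<phi> (real n) \<omega> z) \<in> borel_measurable M" for n z
    by (simp add: measurable_flow)
  have null: "AE \<omega> in M. \<exists>n. norm (\<phi> (real n) \<omega> x - \<phi> (real n) \<omega> y) < \<eta>" if "0 < \<eta>" for \<eta>
  proof -
    let ?N = "{\<omega> \<in> space M. \<forall>n. \<eta> \<le> norm (\<phi> (real n) \<omega> x - \<phi> (real n) \<omega> y)}"
    have [measurable]: "?N \<in> sets M" by measurable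
    have "prob ?N \<le> prob (?D \<eta> (real n))" for n
      by (intro finite_measure_mono) auto
    moreover have "(\<lambda>n. prob (?D \<eta> (real n))) \<longlonglongrightarrow> 0"
      using prob0[OF that] filterlim_real_sequentially by (rule filterlim_compose)
    ultimately have "prob ?N \<le> 0" by (intro LIMSEQ_le_const) auto
    then have "prob ?N = 0" using measure_nonneg[of M ?N] by linarith
    then have "AE \<omega> in M. \<omega> \<notin> ?N" using prob_eq_0[of ?N] by simp
    then show ?thesis using AE_space by eventually_elim (auto simp: not_le)
  qed
  then have "AE \<omega> in M. \<forall>k. \<exists>n. norm (\<phi> (real n) \<omega> x - \<phi> (real n) \<omega> y) < 1 / real (Suc k)"
    by (simp add: AE_all_countable)
  then show ?thesis using AE_space
  proof eventually_elim
    case (elim \<omega>)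
    show ?case
    proof (rule order_tendstoI)
      fix e :: real assume "0 < e"
      then obtain k where k: "1 / real (Suc k) < e" using nat_approx_posE by blast
      obtain n where n: "norm (\<phi> (real n) \<omega> x - \<phi> (real n) \<omega> y) < 1 / real (Suc k)"
        using elim by blast
      show "\<forall>\<^sub>F t in at_top. norm (\<phi> t \<omega> x - \<phi> t \<omega> y) < e"
        using eventually_ge_at_top[of "real n"]
      proof eventually_elim
        case t: (elim t)
        then show ?case
          using contractive_mono_time[OF con elim(2) _ t, of x y] n k by simp
      qed
    qed (auto intro!: always_eventually elim: less_le_trans)
  qed
qed

text \<open>
  Two points of \<open>S\<close> synchronize because both synchronize with a common upper bound.  A countable
  dense subset of \<open>S\<close> provides one null set for all pairs.
\<close>

lemma dense_synchronization:
  assumes con: "contractive_rds M \<phi>" and P: "markovian_semigroup (rds_semigroup M \<phi>)"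
    and erg: "weak_star_mean_ergodic (rds_semigroup M \<phi>)" and ord: "order_condition M \<phi>"
  obtains D where "countable D" "closure D = UNIV"
    "AE \<omega> in M. \<forall>x\<in>D. \<forall>y\<in>D. ((\<lambda>t. norm (\<phi> t \<omega> x - \<phi> t \<omega> y)) \<longlongrightarrow> 0) at_top"
proof -
  obtain C S where C: "order_cone C" and S: "closure S = UNIV"
    and mono: "monotone_rds_on M \<phi> C S"
    and dir: "\<And>x y. x \<in> S \<Longrightarrow> y \<in> S \<Longrightarrow> \<exists>z\<in>S. cone_le C x z \<and> cone_le C y z"
    using ord by (auto simp: order_condition_def)
  have le: "AE \<omega> in M. ((\<lambda>t. norm (\<phi> t \<omega> x - \<phi> t \<omega> y)) \<longlongrightarrow> 0) at_top"
    if "x \<in> S" "y \<in> S" "cone_le C x y" for x y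
    by (rule distance_tendsto_AE_if_tendsto_prob[OF con
          ordered_pair_distance_tendsto_prob[OF con P erg C mono that]])
  have all: "AE \<omega> in M. ((\<lambda>t. norm (\<phi> t \<omega> x - \<phi> t \<omega> y)) \<longlongrightarrow> 0) at_top"
    if xy: "x \<in> S" "y \<in> S" for x y
  proof -
    obtain z where z: "z \<in> S" "cone_le C x z" "cone_le C y z" using dir xy by blast
    show ?thesis using le[OF xy(1) z(1,2)] le[OF xy(2) z(1,3)]
    proof eventually_elim
      case (elim \<omega>)
      from tendsto_add[OF elim]
      have sum: "((\<lambda>t. norm (\<phi> t \<omega> x - \<phi> t \<omega> z) + norm (\<phi> t \<omega> y - \<phi> t \<omega> z)) \<longlongrightarrow> 0) at_top"
        by simp
      have "norm (\<phi> t \<omega> x - \<phi> t \<omega> y)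
          \<le> norm (\<phi> t \<omega> x - \<phi> t \<omega> z) + norm (\<phi> t \<omega> y - \<phi> t \<omega> z)" for t
        using dist_triangle2[of "\<phi> t \<omega> x" "\<phi> t \<omega> y" "\<phi> t \<omega> z"] by (simp add: dist_norm)
      then show ?case by (intro tendsto_0_le[OF sum, of _ 1]) (auto intro!: always_eventually)
    qed
  qed
  \<comment> \<open>The points have to be chosen in \<open>S\<close>, not merely in the whole space.\<close>
  obtain D where D: "countable D" "D \<subseteq> S" "S \<subseteq> closure D" using separable by blast
  have "closure D = UNIV" using D(3) S by (metis closure_closure closure_mono top.extremum_uniqueI)
  moreover have "AE \<omega> in M. \<forall>x\<in>D. \<forall>y\<in>D. ((\<lambda>t. norm (\<phi> t \<omega> x - \<phi> t \<omega> y)) \<longlongrightarrow> 0) at_top"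
    using D(2) by (intro AE_ball_countable' D(1) all) auto
  ultimately show ?thesis using that D(1) by blast
qed

text \<open>
  A finite net of the compact set taken from \<open>D\<close> synchronizes, and nonexpansiveness keeps every
  point of the set as close to the net as it was at time 0.  The argument is pathwise, so the set may
  depend on \<open>\<omega>\<close>.
\<close>

lemma compact_diameter_tendsto_0:
  assumes con: "contractive_rds M \<phi>" and \<omega>: "\<omega> \<in> space M" and D: "closure D = UNIV"
    and sync: "\<And>x y. x \<in> D \<Longrightarrow> y \<in> D \<Longrightarrow> ((\<lambda>t. norm (\<phi> t \<omega> x - \<phi> t \<omega> y)) \<longlongrightarrow> 0) at_top"
    and K: "compact K"
  shows "((\<lambda>t. diameter (\<phi> t \<omega> ` K)) \<longlongrightarrow> 0) at_top"
proof (rule tendstoI)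
  fix e :: real assume e: "0 < e"
  have "K \<subseteq> (\<Union>p\<in>D. ball p (e / 6))"
  proof
    fix x assume "x \<in> K"
    have "x \<in> closure D" using D by simp
    then obtain p where "p \<in> D" "dist p x < e / 6"
      using e closure_approachable[of x D] by (meson divide_pos_pos zero_less_numeral)
    then show "x \<in> (\<Union>p\<in>D. ball p (e / 6))" by auto
  qed
  then obtain F where F: "F \<subseteq> D" "finite F" "K \<subseteq> (\<Union>p\<in>F. ball p (e / 6))"
    using compactE_image[OF K, of D "\<lambda>p. ball p (e / 6)"] by auto
  have "\<forall>\<^sub>F t in at_top. \<forall>p\<in>F. \<forall>q\<in>F. norm (\<phi> t \<omega> p - \<phi> t \<omega> q) < e / 6"
    using F(1,2) e by (intro eventually_ball_finite ballI order_tendstoD(2)[OF sync]) auto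
  then show "\<forall>\<^sub>F t in at_top. dist (diameter (\<phi> t \<omega> ` K)) 0 < e"
    using eventually_ge_at_top[of 0]
  proof eventually_elim
    case (elim t)
    have "norm (\<phi> t \<omega> x - \<phi> t \<omega> y) \<le> e / 2" if xy: "x \<in> K" "y \<in> K" for x y
    proof -
      obtain p where p: "p \<in> F" "dist p x < e / 6" using F(3) xy(1) by auto
      obtain q where q: "q \<in> F" "dist q y < e / 6" using F(3) xy(2) by auto
      have "dist (\<phi> t \<omega> p) (\<phi> t \<omega> x) < e / 6" "dist (\<phi> t \<omega> q) (\<phi> t \<omega> y) < e / 6"
        using contractive_le_initial[OF con \<omega> elim(2), of p x]
          contractive_le_initial[OF con \<omega> elim(2), of q y] p q by (auto simp: dist_norm)
      moreover have "dist (\<phi> t \<omega> p) (\<phi> t \<omega> q) < e / 6" using elim(1) p q by (auto simp: dist_norm)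
      ultimately show ?thesis
        using dist_triangle[of "\<phi> t \<omega> x" "\<phi> t \<omega> y" "\<phi> t \<omega> p"]
          dist_triangle[of "\<phi> t \<omega> p" "\<phi> t \<omega> y" "\<phi> t \<omega> q"]
        by (simp add: dist_norm norm_minus_commute)
    qed
    then have "diameter (\<phi> t \<omega> ` K) \<le> e / 2" using e by (intro diameter_le) auto
    moreover have "compact (\<phi> t \<omega> ` K)"
    proof (rule compact_continuous_image[OF _ K])
      have "1-lipschitz_on K (\<phi> t \<omega>)"
        using contractive_le_initial[OF con \<omega> elim(2)] by (intro lipschitz_onI) (auto simp: dist_norm)
      then show "continuous_on K (\<phi> t \<omega>)" by (rule lipschitz_on_continuous_on)
    qed
    ultimately show ?case using e by (simp add: diameter_ge_0 compact_imp_bounded)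
  qed
qed
end

section \<open>Random compact sets and invariance\<close>

lemma borel_measurable_if_dist_measurable:
  fixes a :: "'w \<Rightarrow> 'h::{metric_space, second_countable_topology}"
  assumes [measurable]: "\<And>p. (\<lambda>\<omega>. dist p (a \<omega>)) \<in> borel_measurable M"
  shows "a \<in> borel_measurable M"
proof (rule borel_measurableI)
  fix U :: "'h set" assume "open U"
  let ?B = "{ball p r |p r. ball p r \<subseteq> U}"
  obtain B' where B': "B' \<subseteq> ?B" "countable B'" "\<Union>B' = \<Union>?B"
    using Lindelof[of ?B] by auto
  have "x \<in> \<Union>?B" if "x \<in> U" for x
  proof -
    obtain r where "0 < r" "ball x r \<subseteq> U" using openE[OF \<open>open U\<close> \<open>x \<in> U\<close>] .
    then show ?thesis by (intro UnionI[of "ball x r"]) auto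
  qed
  then have "U = \<Union>?B" by blast
  then have "a -` U \<inter> space M = (\<Union>b\<in>B'. a -` b \<inter> space M)" using B'(3) by auto
  moreover have "a -` b \<inter> space M \<in> sets M" if "b \<in> B'" for b
  proof -
    obtain p r where b: "b = ball p r" using B'(1) \<open>b \<in> B'\<close> by blast
    have "a -` b \<inter> space M = {\<omega> \<in> space M. dist p (a \<omega>) < r}" by (auto simp: b)
    then show ?thesis by simp
  qed
  ultimately show "a -` U \<inter> space M \<in> sets M"
    using sets.countable_UN''[OF B'(2)] by metis
qed

text \<open>
  The event is expressed through the measurable distance functions alone: two points of the
  fibre at distance more than \<open>\<eta>\<close> are detected by points \<open>p\<close>, \<open>q\<close> of a countable dense set that
  are within \<open>1 / Suc k\<close> of the fibre and more than \<open>\<eta> + 2 / Suc k\<close> apart.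
\<close>

lemma measurable_fibre_distance_gt:
  fixes K :: "'w \<Rightarrow> 'h::{metric_space, second_countable_topology} set"
  assumes K: "random_compact_set M K" and ne: "\<And>\<omega>. \<omega> \<in> space M \<Longrightarrow> K \<omega> \<noteq> {}"
  shows "{\<omega> \<in> space M. \<exists>x\<in>K \<omega>. \<exists>y\<in>K \<omega>. \<eta> < dist x y} \<in> sets M"
proof -
  have [measurable]: "(\<lambda>\<omega>. infdist x (K \<omega>)) \<in> borel_measurable M" for x
    using K by (simp add: random_compact_set_def)
  obtain D :: "'h set" where D: "countable D" "UNIV \<subseteq> closure D" using separable by metis
  note [measurable] = D(1)
  let ?E = "\<lambda>\<omega>. \<exists>p\<in>D. \<exists>q\<in>D. \<exists>k::nat. infdist p (K \<omega>) < 1 / Suc k \<and> infdist q (K \<omega>) < 1 / Suc k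
      \<and> \<eta> < dist p q - 2 / Suc k"
  have "(\<exists>x\<in>K \<omega>. \<exists>y\<in>K \<omega>. \<eta> < dist x y) \<longleftrightarrow> ?E \<omega>" if "\<omega> \<in> space M" for \<omega>
  proof
    assume "\<exists>x\<in>K \<omega>. \<exists>y\<in>K \<omega>. \<eta> < dist x y"
    then obtain x y where xy: "x \<in> K \<omega>" "y \<in> K \<omega>" "\<eta> < dist x y" by blast
    then obtain k where k: "1 / real (Suc k) < (dist x y - \<eta>) / 4"
      using nat_approx_posE[of "(dist x y - \<eta>) / 4"] by auto
    have near: "\<exists>p\<in>D. dist p z < 1 / real (Suc k)" for z
      using D(2) closure_approachable[of z D] by (simp add: subset_iff)
    obtain p where p: "p \<in> D" "dist p x < 1 / real (Suc k)" using near by blast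
    obtain q where q: "q \<in> D" "dist q y < 1 / real (Suc k)" using near by blast
    have "infdist p (K \<omega>) < 1 / Suc k" "infdist q (K \<omega>) < 1 / Suc k"
      using infdist_le[OF xy(1), of p] infdist_le[OF xy(2), of q] p q by auto
    moreover have "dist x y \<le> dist p x + dist p q + dist q y"
      using dist_triangle[of x y p] dist_triangle[of p y q] by (simp add: dist_commute)
    then have "\<eta> < dist p q - 2 / Suc k" using k p q by simp
    ultimately show "?E \<omega>" using p(1) q(1) by blast
  next
    assume "?E \<omega>"
    then obtain p q and k :: nat where pq: "infdist p (K \<omega>) < 1 / Suc k" "infdist q (K \<omega>) < 1 / Suc k"
      "\<eta> < dist p q - 2 / Suc k" by blast
    obtain x where x: "x \<in> K \<omega>" "dist p x < 1 / Suc k" using infdist_lessE[OF pq(1) ne[OF \<open>\<omega> \<in> space M\<close>]] .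
    obtain y where y: "y \<in> K \<omega>" "dist q y < 1 / Suc k" using infdist_lessE[OF pq(2) ne[OF \<open>\<omega> \<in> space M\<close>]] .
    have "dist p q \<le> dist p x + dist x y + dist q y"
      using dist_triangle[of p q x] dist_triangle[of x q y] by (simp add: dist_commute)
    then show "\<exists>x\<in>K \<omega>. \<exists>y\<in>K \<omega>. \<eta> < dist x y" using x y pq(3) by force
  qed
  then have "{\<omega> \<in> space M. \<exists>x\<in>K \<omega>. \<exists>y\<in>K \<omega>. \<eta> < dist x y} = {\<omega> \<in> space M. ?E \<omega>}" by blast
  also have "\<dots> \<in> sets M" by measurable
  finally show ?thesis .
qed

text \<open>
  On the measurable set where the fibre is a single point, the distance of \<open>p\<close> to this point is
  the distance of \<open>p\<close> to the fibre; elsewhere a constant is selected.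
\<close>

lemma measurable_selection_of_singletons:
  fixes K :: "'w \<Rightarrow> 'h::{metric_space, second_countable_topology} set"
  assumes K: "random_compact_set M K" and ne: "\<And>\<omega>. \<omega> \<in> space M \<Longrightarrow> K \<omega> \<noteq> {}"
    and AE0: "AE \<omega> in M. \<forall>x\<in>K \<omega>. \<forall>y\<in>K \<omega>. x = y"
  shows "\<exists>a\<in>borel_measurable M. AE \<omega> in M. K \<omega> = {a \<omega>}"
proof -
  define G where "G = space M - {\<omega> \<in> space M. \<exists>x\<in>K \<omega>. \<exists>y\<in>K \<omega>. 0 < dist x y}"
  have [measurable]: "G \<in> sets M"
    unfolding G_def using measurable_fibre_distance_gt[OF K ne, of 0] by (intro sets.Diff sets.top)
  have [measurable]: "(\<lambda>\<omega>. infdist x (K \<omega>)) \<in> borel_measurable M" for x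
    using K by (simp add: random_compact_set_def)
  define a where "a \<omega> = (if \<omega> \<in> G then SOME x. x \<in> K \<omega> else undefined)" for \<omega>
  have single: "K \<omega> = {a \<omega>}" if "\<omega> \<in> G" for \<omega>
  proof -
    have "a \<omega> \<in> K \<omega>"
      using that ne[of \<omega>] some_in_eq[of "K \<omega>"] by (simp add: a_def G_def)
    then show ?thesis using that by (auto simp: G_def)
  qed
  have "a \<in> borel_measurable M"
  proof (rule borel_measurable_if_dist_measurable)
    fix p
    have eq: "dist p (a \<omega>) = (if \<omega> \<in> G then infdist p (K \<omega>) else dist p undefined)" for \<omega>
    proof (cases "\<omega> \<in> G")
      case True
      then show ?thesis by (simp add: single[OF True])
    next
      case False
      then show ?thesis by (simp add: a_def)
    qed
    show "(\<lambda>\<omega>. dist p (a \<omega>)) \<in> borel_measurable M" unfolding eq by measurable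
  qed
  moreover have "AE \<omega> in M. K \<omega> = {a \<omega>}"
    using AE0 AE_space by eventually_elim (rule single, simp add: G_def)
  ultimately show ?thesis by blast
qed

text \<open>
  By invariance the fibre over \<open>\<theta> n \<omega>\<close> is the image of the fibre over \<open>\<omega>\<close>, so it is eventually
  small.  By stationarity the probability that it has two points at distance more than \<open>\<eta>\<close> does
  not depend on \<open>n\<close>, so this probability is 0.
\<close>

lemma (in random_dynamical_system) invariant_set_subsingleton:
  assumes K: "random_compact_set M K" and ne: "\<And>\<omega>. \<omega> \<in> space M \<Longrightarrow> K \<omega> \<noteq> {}"
    and inv: "invariant_random_set M \<theta> \<phi> K"
    and lim: "AE \<omega> in M. ((\<lambda>t. diameter (\<phi> t \<omega> ` K \<omega>)) \<longlongrightarrow> 0) at_top"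
    and con: "contractive_rds M \<phi>"
  shows "AE \<omega> in M. \<forall>x\<in>K \<omega>. \<forall>y\<in>K \<omega>. x = y"
proof -
  have null: "AE \<omega> in M. \<forall>x\<in>K \<omega>. \<forall>y\<in>K \<omega>. dist x y \<le> \<eta>" if "0 < \<eta>" for \<eta>
  proof -
    let ?A = "{\<omega> \<in> space M. \<exists>x\<in>K \<omega>. \<exists>y\<in>K \<omega>. \<eta> < dist x y}"
    have A [measurable]: "?A \<in> sets M" by (rule measurable_fibre_distance_gt[OF K ne])
    have \<theta> [measurable]: "\<theta> t \<in> M \<rightarrow>\<^sub>M M" for t
      using measurable_compose[OF measurable_Pair1'[of t borel M] theta_measurable] by simp
    have stationary: "prob ?A = (\<integral>\<omega>. indicator ?A (\<theta> (real n) \<omega>) \<partial>M)" for n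
    proof -
      have "prob ?A = (\<integral>\<omega>. indicator ?A \<omega> \<partial>distr M M (\<theta> (real n)))"
        using theta_preserving by simp
      also have "\<dots> = (\<integral>\<omega>. indicator ?A (\<theta> (real n) \<omega>) \<partial>M)"
        by (rule integral_distr) measurable
      finally show ?thesis .
    qed
    have "AE \<omega> in M. \<forall>n. \<phi> (real n) \<omega> ` K \<omega> = K (\<theta> (real n) \<omega>)"
      using inv by (simp add: AE_all_countable invariant_random_set_def)
    with lim have "AE \<omega> in M. (\<lambda>n. indicator ?A (\<theta> (real n) \<omega>) :: real) \<longlonglongrightarrow> 0"
      using AE_space
    proof eventually_elim
      case (elim \<omega>)
      have "(\<lambda>n. diameter (\<phi> (real n) \<omega> ` K \<omega>)) \<longlonglongrightarrow> 0"
        using elim(1) filterlim_real_sequentially by (rule filterlim_compose)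
      then have "\<forall>\<^sub>F n in sequentially. diameter (\<phi> (real n) \<omega> ` K \<omega>) < \<eta>"
        using that by (rule order_tendstoD)
      then have "\<forall>\<^sub>F n in sequentially. indicator ?A (\<theta> (real n) \<omega>) = (0 :: real)"
      proof eventually_elim
        case n: (elim n)
        have "\<theta> (real n) \<omega> \<in> space M" using elim(3) measurable_space[OF \<theta>] by blast
        then have "bounded (K (\<theta> (real n) \<omega>))"
          using K by (auto simp: random_compact_set_def compact_imp_bounded)
        then have "dist x y \<le> \<eta>" if "x \<in> K (\<theta> (real n) \<omega>)" "y \<in> K (\<theta> (real n) \<omega>)" for x y
          using diameter_bounded_bound[of "K (\<theta> (real n) \<omega>)" x y] that n elim(2) by simp
        then show ?case by (force simp: indicator_def)
      qed
      then show ?case by (rule tendsto_eventually)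
    qed
    then have "(\<lambda>n. \<integral>\<omega>. indicator ?A (\<theta> (real n) \<omega>) \<partial>M) \<longlonglongrightarrow> (\<integral>\<omega>. (0::real) \<partial>M)"
      by (intro integral_dominated_convergence[where w = "\<lambda>_. 1"]) (auto simp: indicator_def)
    then have "prob ?A = 0"
      unfolding stationary[symmetric] by (simp add: LIMSEQ_const_iff)
    then have "AE \<omega> in M. \<omega> \<notin> ?A" using prob_eq_0[OF A] by simp
    then show ?thesis using AE_space by eventually_elim (auto simp: not_less)
  qed
  have "AE \<omega> in M. \<forall>k. \<forall>x\<in>K \<omega>. \<forall>y\<in>K \<omega>. dist x y \<le> 1 / real (Suc k)"
    using null by (simp add: AE_all_countable)
  then show ?thesis
  proof eventually_elim
    case (elim \<omega>)
    show ?case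
    proof (intro ballI, rule ccontr)
      fix x y assume xy: "x \<in> K \<omega>" "y \<in> K \<omega>" "x \<noteq> y"
      then obtain k where "1 / real (Suc k) < dist x y" using nat_approx_posE[of "dist x y"] by auto
      moreover have "dist x y \<le> 1 / real (Suc k)" using elim xy(1,2) by blast
      ultimately show False by simp
    qed
  qed
qed

theorem theorem3p8:
  fixes M :: "'w measure"
    and \<theta> :: "real \<Rightarrow> 'w \<Rightarrow> 'w"
    and \<phi> :: "real \<Rightarrow> 'w \<Rightarrow> 'h::{real_inner, polish_space} \<Rightarrow> 'h"
  assumes "random_dynamical_system M \<theta> \<phi>"
    and "contractive_rds M \<phi>"
    and "order_condition M \<phi>"
    and "markovian_semigroup (rds_semigroup M \<phi>)"
    and "weak_star_mean_ergodic (rds_semigroup M \<phi>)"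
  shows "(\<forall>K. random_compact_set M K \<longrightarrow>
            (AE \<omega> in M. ((\<lambda>t. diameter (\<phi> t \<omega> ` K \<omega>)) \<longlongrightarrow> 0) at_top)) \<and>
         (\<forall>K. random_compact_set M K \<and> (\<forall>\<omega>\<in>space M. K \<omega> \<noteq> {}) \<and>
              invariant_random_set M \<theta> \<phi> K \<longrightarrow>
            (\<exists>a\<in>borel_measurable M. AE \<omega> in M. K \<omega> = {a \<omega>}))"
proof -
  interpret random_dynamical_system M \<theta> \<phi> by fact
  obtain D where "countable D" and D: "closure D = (UNIV :: 'h set)"
    "AE \<omega> in M. \<forall>x\<in>D. \<forall>y\<in>D. ((\<lambda>t. norm (\<phi> t \<omega> x - \<phi> t \<omega> y)) \<longlongrightarrow> 0) at_top"
    by (rule dense_synchronization[OF assms(2,4,5,3)])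
  have sync: "AE \<omega> in M. ((\<lambda>t. diameter (\<phi> t \<omega> ` K \<omega>)) \<longlongrightarrow> 0) at_top"
    if K: "random_compact_set M K" for K
    using D(2) AE_space
  proof eventually_elim
    case (elim \<omega>)
    then show ?case
      using K by (intro compact_diameter_tendsto_0[OF assms(2) _ D(1)])
        (auto simp: random_compact_set_def)
  qed
  moreover have "\<exists>a\<in>borel_measurable M. AE \<omega> in M. K \<omega> = {a \<omega>}"
    if "random_compact_set M K" "\<forall>\<omega>\<in>space M. K \<omega> \<noteq> {}" "invariant_random_set M \<theta> \<phi> K" for K
  proof (rule measurable_selection_of_singletons[OF that(1)])
    show "K \<omega> \<noteq> {}" if "\<omega> \<in> space M" for \<omega>
      using \<open>\<forall>\<omega>\<in>space M. K \<omega> \<noteq> {}\<close> that by blast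
    then show "AE \<omega> in M. \<forall>x\<in>K \<omega>. \<forall>y\<in>K \<omega>. x = y"
      by (rule invariant_set_subsingleton[OF that(1) _ that(3) sync[OF that(1)] assms(2)])
  qed
  ultimately show ?thesis by blast
qed

end
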